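(* Let $f\in\mathbb{F}[x_1,\dots,x_n]$ be homogeneous of degree $d$. Then $g=\Xi(f)$ is the unique polynomial such that (1) $g-f$ has degree $<d$, and (2) $g(-\overline\eta)=0$ for all compositions $\eta$ with $|\eta|<d$.
   Context: Fix $n\ge1$; $r$ is an indeterminate, $\alpha=1/r$, $\mathbb{F}=\mathbb{Q}(r)$. Compositions are $\eta\in\mathbb{N}^n$, $|\eta|=\sum\eta_i$, $x^\eta=\prod x_i^{\eta_i}$; partitions are weakly decreasing compositions; $\delta=(n-1,\dots,0)$; permutations act on vectors by $(wv)_{w(i)}=v_i$; $w_\gamma$ is the minimal-length permutation with $w_\gamma^{-1}(\gamma)$ a partition, and $\overline\gamma=\gamma+w_\gamma(r\delta)$. $E_\eta^{r\delta}$ is the unique polynomial of degree $|\eta|$ vanishing at all $\overline\gamma$ with $\gamma\ne\eta$, $|\gamma|\le|\eta|$, with coefficient $1$ on $x^\eta$; $E_\eta^{(\alpha)}$ its top homogeneous component. With $a_\eta(i,j)=\eta_i-j$, $l_\eta(i,j)=\#\{k>i:j\le\eta_k\le\eta_i\}+\#\{k<i:j\le\eta_k+1\le\eta_i\}$, $d_\eta(\alpha)=\prod_{1\le j\le\eta_i}(\alpha(a_\eta(i,j)+1)+l_\eta(i,j)+1)$, set $F_\eta^{(\alpha)}=d_\eta E_\eta^{(\alpha)}$, $F_\eta^{r\delta}(x)=(-1)^{|\eta|}d_\eta E_\eta^{r\delta}(-x)$; $\Xi$ is the unique $\mathbb{F}$-linear operator on $\mathbb{F}[x_1,\dots,x_n]$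 with $\Xi(F_\eta^{(\alpha)})=F_\eta^{r\delta}$ for all $\eta$. *)

theory Defs
  imports
    "HOL-Library.Poly_Mapping"
    "HOL-Library.Extended_Real"
    "HOL-Computational_Algebra.Polynomial_Factorial"
begin

text \<open>
  The positions \<open>1 < \<dots> < n\<close> are the elements of a finite, linearly ordered type \<open>'n\<close> (so
  \<open>n = CARD('n) \<ge> 1\<close>). A composition doubles as the exponent vector of its monomial
  \<open>x\<^sup>\<eta>\<close>, and a polynomial is a finitely supported family of coefficients indexed by exponent
  vectors. The coefficient field is \<open>\<rat>(r)\<close>, the fraction field of \<open>\<rat>[r]\<close>.
\<close>

type_synonym ratfun = "rat poly fract"
type_synonym 'n composition = "'n \<Rightarrow>\<^sub>0 nat"
type_synonym 'n mpoly = "'n composition \<Rightarrow>\<^sub>0 ratfun"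

abbreviation lookup :: "('a \<Rightarrow>\<^sub>0 'b::zero) \<Rightarrow> 'a \<Rightarrow> 'b" where
  "lookup \<equiv> Poly_Mapping.lookup"

abbreviation keys :: "('a \<Rightarrow>\<^sub>0 'b::zero) \<Rightarrow> 'a set" where
  "keys \<equiv> Poly_Mapping.keys"

definition r :: ratfun where
  "r = to_fract [:0, 1:]"

definition \<alpha> :: ratfun where
  "\<alpha> = 1 / r"

definition wt :: "'n::finite composition \<Rightarrow> nat" where
  "wt \<eta> = (\<Sum>i\<in>UNIV. lookup \<eta> i)"


subsection \<open>Polynomials\<close>

definition Const :: "ratfun \<Rightarrow> 'n mpoly" where
  "Const c = Poly_Mapping.single 0 c"

definition Var :: "'n \<Rightarrow> 'n mpoly" where
  "Var i = Poly_Mapping.single (Poly_Mapping.single i 1) 1"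

definition scale :: "ratfun \<Rightarrow> 'n mpoly \<Rightarrow> 'n mpoly" where
  "scale c p = Const c * p"

definition eval :: "'n::finite mpoly \<Rightarrow> ('n \<Rightarrow> ratfun) \<Rightarrow> ratfun" where
  "eval p v = (\<Sum>m\<in>keys p. lookup p m * (\<Prod>i\<in>UNIV. v i ^ lookup m i))"

definition subst :: "('n \<Rightarrow> 'n mpoly) \<Rightarrow> 'n::finite mpoly \<Rightarrow> 'n mpoly" where
  "subst q p = (\<Sum>m\<in>keys p. Const (lookup p m) * (\<Prod>i\<in>UNIV. q i ^ lookup m i))"

text \<open>The total degree; the supremum of the empty set gives the zero polynomial degree \<open>-\<infinity>\<close>.\<close>

definition deg :: "'n::finite mpoly \<Rightarrow> ereal" where
  "deg p = (SUP m\<in>keys p. ereal (real (wt m)))"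

definition homogeneous :: "nat \<Rightarrow> 'n::finite mpoly \<Rightarrow> bool" where
  "homogeneous d p \<longleftrightarrow> (\<forall>m\<in>keys p. wt m = d)"

definition hom_component :: "nat \<Rightarrow> 'n::finite mpoly \<Rightarrow> 'n mpoly" where
  "hom_component d p = (\<Sum>m\<in>{m \<in> keys p. wt m = d}. Poly_Mapping.single m (lookup p m))"


subsection \<open>Interpolation points\<close>

text \<open>The action on vectors is \<open>(wv)\<^bsub>w(i)\<^esub> = v\<^sub>i\<close>.\<close>

definition perm_act :: "('n \<Rightarrow> 'n) \<Rightarrow> ('n \<Rightarrow> 'a) \<Rightarrow> 'n \<Rightarrow> 'a" where
  "perm_act w v = v \<circ> inv w"

definition perm_length :: "('n::{finite,linorder} \<Rightarrow> 'n) \<Rightarrow> nat" where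
  "perm_length w = card {(i, j). i < j \<and> w j < w i}"

definition sorting_perm :: "'n::{finite,linorder} composition \<Rightarrow> 'n \<Rightarrow> 'n" where
  "sorting_perm \<gamma> =
     (ARG_MIN perm_length w. bij w \<and> antimono (perm_act (inv w) (lookup \<gamma>)))"

text \<open>\<open>\<delta> = (n-1, \<dots>, 0)\<close>: the \<open>i\<close>-th entry is the number of positions after \<open>i\<close>.\<close>

definition \<delta> :: "'n::{finite,linorder} \<Rightarrow> nat" where
  "\<delta> i = card {k. i < k}"

definition bar :: "'n::{finite,linorder} composition \<Rightarrow> 'n \<Rightarrow> ratfun" where
  "bar \<gamma> i = of_nat (lookup \<gamma> i) + perm_act (sorting_perm \<gamma>) (\<lambda>k. r * of_nat (\<delta> k)) i"


subsection \<open>Interpolation polynomials and the operator\<close>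

definition E_interp :: "'n::{finite,linorder} composition \<Rightarrow> 'n mpoly" where
  "E_interp \<eta> =
     (THE p. deg p = ereal (real (wt \<eta>)) \<and>
             (\<forall>\<gamma>. \<gamma> \<noteq> \<eta> \<and> wt \<gamma> \<le> wt \<eta> \<longrightarrow> eval p (bar \<gamma>) = 0) \<and>
             lookup p \<eta> = 1)"

definition E_jack :: "'n::{finite,linorder} composition \<Rightarrow> 'n mpoly" where
  "E_jack \<eta> = hom_component (wt \<eta>) (E_interp \<eta>)"

text \<open>The diagram has boxes \<open>(i, j)\<close> with \<open>1 \<le> j \<le> \<eta>\<^sub>i\<close>, so the subtraction in the arm is exact.\<close>

definition arm :: "'n::{finite,linorder} composition \<Rightarrow> 'n \<Rightarrow> nat \<Rightarrow> nat" where
  "arm \<eta> i j = lookup \<eta> i - j"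

definition leg :: "'n::{finite,linorder} composition \<Rightarrow> 'n \<Rightarrow> nat \<Rightarrow> nat" where
  "leg \<eta> i j =
     card {k. k > i \<and> j \<le> lookup \<eta> k \<and> lookup \<eta> k \<le> lookup \<eta> i} +
     card {k. k < i \<and> j \<le> lookup \<eta> k + 1 \<and> lookup \<eta> k + 1 \<le> lookup \<eta> i}"

definition hook :: "'n::{finite,linorder} composition \<Rightarrow> ratfun" where
  "hook \<eta> =
     (\<Prod>i\<in>UNIV. \<Prod>j\<in>{1..lookup \<eta> i}.
        \<alpha> * (of_nat (arm \<eta> i j) + 1) + of_nat (leg \<eta> i j) + 1)"

definition F_jack :: "'n::{finite,linorder} composition \<Rightarrow> 'n mpoly" where
  "F_jack \<eta> = scale (hook \<eta>) (E_jack \<eta>)"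

definition F_interp :: "'n::{finite,linorder} composition \<Rightarrow> 'n mpoly" where
  "F_interp \<eta> = scale ((-1) ^ wt \<eta> * hook \<eta>) (subst (\<lambda>i. - Var i) (E_interp \<eta>))"

definition \<Xi> :: "'n::{finite,linorder} mpoly \<Rightarrow> 'n mpoly" where
  "\<Xi> = (THE T. Vector_Spaces.linear scale scale T \<and> (\<forall>\<eta>. T (F_jack \<eta>) = F_interp \<eta>))"

end

theory Submission
  imports Defs "HOL-Library.FuncSet"
begin

text \<open>
  The points \<open>bar \<gamma>\<close> carry a triangular Newton basis. Reading the boxes \<open>(i, t)\<close>, \<open>t < \<eta>\<^sub>i\<close>, column
  by column with \<open>t\<close> ascending and \<open>i\<close> descending orders the compositions lexicographically, and
  the product of linear factors \<open>x\<^sub>i - node \<eta> i t\<close> over all boxes has leading term \<open>x\<^sup>\<eta>\<close>, does not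
  vanish at \<open>bar \<eta>\<close>, and vanishes at \<open>bar \<gamma>\<close> for every \<open>\<gamma>\<close> preceding \<open>\<eta>\<close>: at the first box present
  in \<open>\<eta>\<close> but missing from \<open>\<gamma>\<close>, the node equals \<open>bar \<gamma> i\<close>. Inverting the triangular evaluation
  matrix yields a Lagrange basis in each degree, in which the coefficient of \<open>x\<^sup>\<eta>\<close> is the inverse of
  a diagonal entry, hence nonzero. So the interpolation polynomials exist, a polynomial of degree
  \<open>\<le> d\<close> vanishing at all \<open>bar \<gamma>\<close> with \<open>|\<gamma>| \<le> d\<close> is zero, and the \<open>F_jack \<eta>\<close> span. Conditions (1)
  and (2) hold for the pairs \<open>(F_jack \<eta>, F_interp \<eta>)\<close>, are linear, and determine \<open>g\<close>.
\<close>

section \<open>Inverses of triangular matrices\<close>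

text \<open>The second hypothesis makes \<open>M\<close> upper triangular along \<open>xs\<close>:
  the head column is zero below the diagonal, so the head row can be solved for last. The inverse is
  again triangular with nonzero diagonal, so the lemma applies to it in turn.\<close>

lemma triangular_right_inverse:
  fixes M :: "'a \<Rightarrow> 'a \<Rightarrow> 'b::field"
  assumes "distinct xs" "sorted_wrt (\<lambda>a b. M b a = 0) xs" "\<And>a. a \<in> set xs \<Longrightarrow> M a a \<noteq> 0"
  shows "\<exists>B. sorted_wrt (\<lambda>a b. B b a = 0) xs \<and> (\<forall>a\<in>set xs. B a a \<noteq> 0) \<and>
    (\<forall>a\<in>set xs. \<forall>b\<in>set xs. (\<Sum>c\<in>set xs. M a c * B c b) = of_bool (a = b))"
  using assms
proof (induction xs)
  case Nil
  then show ?case by simp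
next
  case (Cons x xs)
  from Cons obtain B where B: "sorted_wrt (\<lambda>a b. B b a = 0) xs" "\<forall>a\<in>set xs. B a a \<noteq> 0"
    "\<forall>a\<in>set xs. \<forall>b\<in>set xs. (\<Sum>c\<in>set xs. M a c * B c b) = of_bool (a = b)"
    by auto
  have x: "x \<notin> set xs" "M x x \<noteq> 0" "\<And>a. a \<in> set xs \<Longrightarrow> M a x = 0"
    using Cons.prems by auto
  define B' where "B' = (\<lambda>a b. if a = x then
      (if b = x then 1 / M x x else - (\<Sum>c\<in>set xs. M x c * B c b) / M x x)
    else if b = x then 0 else B a b)"
  have B'_eq: "B' a b = B a b" if "a \<in> set xs" "b \<in> set xs" for a b
    using that x by (auto simp: B'_def)
  have B'_0: "B' a x = 0" if "a \<in> set xs" for a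
    using that x by (auto simp: B'_def)
  have "sorted_wrt (\<lambda>a b. B' b a = 0) (x # xs)"
    using B(1) B'_0 by (auto intro: sorted_wrt_mono_rel[rotated] simp: B'_eq)
  moreover have "\<forall>a\<in>set (x # xs). B' a a \<noteq> 0"
    using B(2) x by (auto simp: B'_def)
  moreover have "(\<Sum>c\<in>set (x # xs). M a c * B' c b) = of_bool (a = b)"
    if a: "a \<in> set (x # xs)" and b: "b \<in> set (x # xs)" for a b
  proof (cases "b = x")
    case True
    have "(\<Sum>c\<in>set xs. M a c * B' c x) = 0"
      by (intro sum.neutral) (auto simp: B'_0)
    then show ?thesis
      using a x True by (auto simp: B'_def)
  next
    case False
    with b have b': "b \<in> set xs" by simp
    have *: "(\<Sum>c\<in>set xs. M a c * B' c b) = (\<Sum>c\<in>set xs. M a c * B c b)"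
      by (intro sum.cong) (auto simp: B'_eq b')
    show ?thesis
    proof (cases "a = x")
      case True
      then show ?thesis using x b' * by (auto simp: B'_def)
    next
      case False
      with a have a': "a \<in> set xs" by simp
      then show ?thesis using x b' B(3) * by auto
    qed
  qed
  ultimately show ?case by blast
qed

text \<open>The right inverse \<open>B\<close> has a right inverse \<open>A\<close> of its own, and
  \<open>A = (M B) A = M (B A) = M\<close> on \<open>xs\<close>; hence \<open>B\<close> is
  two-sided.\<close>

lemma triangular_inverse:
  fixes M :: "'a \<Rightarrow> 'a \<Rightarrow> 'b::field"
  assumes xs: "distinct xs" "sorted_wrt (\<lambda>a b. M b a = 0) xs" "\<And>a. a \<in> set xs \<Longrightarrow> M a a \<noteq> 0"
  obtains B where "\<And>a. a \<in> set xs \<Longrightarrow> B a a \<noteq> 0"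
    "\<And>a b. a \<in> set xs \<Longrightarrow> b \<in> set xs \<Longrightarrow> (\<Sum>c\<in>set xs. M a c * B c b) = of_bool (a = b)"
    "\<And>a b. a \<in> set xs \<Longrightarrow> b \<in> set xs \<Longrightarrow> (\<Sum>c\<in>set xs. B a c * M c b) = of_bool (a = b)"
proof -
  obtain B where B: "sorted_wrt (\<lambda>a b. B b a = 0) xs" "\<forall>a\<in>set xs. B a a \<noteq> 0"
    "\<forall>a\<in>set xs. \<forall>b\<in>set xs. (\<Sum>c\<in>set xs. M a c * B c b) = of_bool (a = b)"
    using triangular_right_inverse[where M = M, OF xs] by blast
  obtain A where
    A: "\<forall>a\<in>set xs. \<forall>b\<in>set xs. (\<Sum>c\<in>set xs. B a c * A c b) = of_bool (a = b)"
    using triangular_right_inverse[where M = B, OF xs(1) B(1)] B(2) by blast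
  have "A a b = M a b" if a: "a \<in> set xs" and b: "b \<in> set xs" for a b
  proof -
    have "A a b = (\<Sum>c\<in>set xs. of_bool (a = c) * A c b)"
      using a by simp
    also have "\<dots> = (\<Sum>c\<in>set xs. (\<Sum>e\<in>set xs. M a e * B e c) * A c b)"
      using B(3) a by (intro sum.cong) auto
    also have "\<dots> = (\<Sum>e\<in>set xs. M a e * (\<Sum>c\<in>set xs. B e c * A c b))"
      by (simp add: sum_distrib_left sum_distrib_right mult.assoc) (rule sum.swap)
    also have "\<dots> = (\<Sum>e\<in>set xs. M a e * of_bool (e = b))"
      using A b by (intro sum.cong) auto
    also have "\<dots> = M a b"
      using b by simp
    finally show ?thesis .
  qed
  then have "(\<Sum>c\<in>set xs. B a c * M c b) = of_bool (a = b)"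
    if "a \<in> set xs" "b \<in> set xs" for a b
    using A that by (metis (no_types, lifting) sum.cong)
  with B show ?thesis using that by blast
qed

section \<open>Nonvanishing in the field of rational functions\<close>

text \<open>Here \<open>r\<close> acts as an indeterminate: the left side is the image of the
  polynomial with coefficients \<open>a\<close> and \<open>b\<close>.\<close>

lemma of_nat_add_r_eq_0_iff: "of_nat a + r * of_nat b = 0 \<longleftrightarrow> a = 0 \<and> b = 0"
proof -
  have of_nat: "(of_nat n :: ratfun) = to_fract [:of_nat n:]" for n
    by (induction n) (auto simp flip: to_fract_1 to_fract_add simp: one_pCons)
  have "of_nat a + r * of_nat b = to_fract [:of_nat a, of_nat b:]"
    by (simp add: of_nat r_def flip: to_fract_mult to_fract_add)
  then show ?thesis by simp
qed

lemma r_neq_0: "r \<noteq> 0"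
  by (simp add: r_def)

text \<open>Multiplication by \<open>r\<close> turns a factor into
  \<open>(a + 1) + r (l + 1)\<close>, which is nonzero.\<close>

lemma hook_neq_0: "hook \<eta> \<noteq> 0"
proof -
  have "\<alpha> * (of_nat a + 1) + of_nat l + 1 \<noteq> 0" for a l
  proof
    assume "\<alpha> * (of_nat a + 1) + of_nat l + 1 = 0"
    then have "r * (\<alpha> * (of_nat a + 1) + of_nat l + 1) = 0" by simp
    then have "of_nat (a + 1) + r * of_nat (l + 1) = 0"
      using r_neq_0 by (simp add: \<alpha>_def algebra_simps)
    then show False unfolding of_nat_add_r_eq_0_iff by simp
  qed
  then show ?thesis by (simp add: hook_def)
qed

section \<open>Coefficients, evaluation and degree\<close>

lemma lookup_single_zero_mult:
  "lookup (Poly_Mapping.single 0 c * p) m = c * lookup (p :: 'a::monoid_add \<Rightarrow>\<^sub>0 'b::semiring_0) m"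
  by transfer (simp add: prod_fun_def when_mult)

lemma lookup_scale [simp]: "lookup (scale c p) m = c * lookup p m"
  by (simp add: scale_def Const_def lookup_single_zero_mult)

lemma vector_space_scale: "vector_space scale"
  by unfold_locales (auto intro!: poly_mapping_eqI simp: lookup_add algebra_simps)

interpretation scale: vector_space scale
  by (rule vector_space_scale)

lemma eval_superset:
  assumes "finite A" "keys p \<subseteq> A"
  shows "eval p v = (\<Sum>m\<in>A. lookup p m * (\<Prod>i\<in>UNIV. v i ^ lookup m i))"
  unfolding eval_def using assms by (intro sum.mono_neutral_left) (auto simp: in_keys_iff)

lemma eval_0 [simp]: "eval 0 v = 0"
  by (simp add: eval_def)

lemma eval_add: "eval (p + q) v = eval p v + eval q v"
proof -
  let ?A = "keys p \<union> keys q"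
  show ?thesis
    using keys_add[of p q]
    by (simp add: eval_superset[of ?A] lookup_add sum.distrib algebra_simps)
qed

lemma eval_scale: "eval (scale c p) v = c * eval p v"
proof -
  have "keys (scale c p) \<subseteq> keys p" by (auto simp: in_keys_iff)
  then show ?thesis
    by (subst eval_superset[of "keys p"]) (simp_all add: eval_def sum_distrib_left mult.assoc)
qed

lemma eval_diff: "eval (p - q) v = eval p v - eval q v"
  using eval_add[of "p - q" q v] by simp

lemma eval_sum: "eval (\<Sum>a\<in>A. p a) v = (\<Sum>a\<in>A. eval (p a) v)"
  by (induction A rule: infinite_finite_induct) (auto simp: eval_add)

lemma deg_le_iff: "deg p \<le> ereal (real d) \<longleftrightarrow> (\<forall>m. d < wt m \<longrightarrow> lookup p m = 0)"
  by (force simp: deg_def SUP_le_iff in_keys_iff)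

lemma deg_less_iff: "deg p < ereal (real d) \<longleftrightarrow> (\<forall>m. d \<le> wt m \<longrightarrow> lookup p m = 0)"
proof
  assume "deg p < ereal (real d)"
  then have "ereal (real (wt m)) < ereal (real d)" if "m \<in> keys p" for m
    using that unfolding deg_def by (meson SUP_upper le_less_trans)
  then show "\<forall>m. d \<le> wt m \<longrightarrow> lookup p m = 0"
    by (force simp: in_keys_iff)
next
  assume *: "\<forall>m. d \<le> wt m \<longrightarrow> lookup p m = 0"
  show "deg p < ereal (real d)"
  proof (cases d)
    case 0
    \<comment> \<open>Every weight is at least 0, so \<open>p\<close> is zero and has degree minus
      infinity.\<close>
    then have "p = 0" using * by (intro poly_mapping_eqI) auto
    then show ?thesis by (simp add: deg_def bot_ereal_def)
  next
    case (Suc k)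
    \<comment> \<open>Strictness survives the supremum because the weights are integers, bounded by
      \<open>d - 1\<close>.\<close>
    then have "deg p \<le> ereal (real k)" unfolding deg_le_iff using * by auto
    also have "\<dots> < ereal (real d)" using Suc by simp
    finally show ?thesis .
  qed
qed

lemma lookup_hom_component: "lookup (hom_component d p) m = (lookup p m when wt m = d)"
proof -
  have "lookup (hom_component d p) m = (\<Sum>k\<in>{m \<in> keys p. wt m = d}. lookup p k when k = m)"
    by (simp add: hom_component_def lookup_sum lookup_single)
  also have "\<dots> = (\<Sum>k\<in>{m \<in> keys p. wt m = d}. if k = m then lookup p k else 0)"
    by (intro sum.cong) (auto simp: when_def)
  also have "\<dots> = (lookup p m when wt m = d)"
    by (auto simp: when_def in_keys_iff)
  finally show ?thesis .
qed

lemma prod_uminus_Var_power: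
  "(\<Prod>i\<in>UNIV. (- Var i) ^ lookup m i) = Poly_Mapping.single m ((-1) ^ wt m)"
proof -
  have "(- Var i) ^ k = Poly_Mapping.single (Poly_Mapping.single i k) ((-1) ^ k)" for i :: 'a and k
    by (induction k) (simp_all add: Var_def mult_single flip: single_uminus single_add)
  moreover have "(\<Prod>i\<in>A. Poly_Mapping.single (f i) (c i)) = Poly_Mapping.single (\<Sum>i\<in>A. f i) (\<Prod>i\<in>A. c i)"
    if "finite A" for A :: "'a set" and f :: "'a \<Rightarrow> 'a composition" and c :: "'a \<Rightarrow> ratfun"
    using that by induction (simp_all add: mult_single)
  moreover have "(\<Sum>i\<in>UNIV. Poly_Mapping.single i (lookup m i)) = m"
    by (intro poly_mapping_eqI) (simp add: lookup_sum lookup_single when_def)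
  ultimately show ?thesis
    by (simp add: wt_def power_sum)
qed

lemma lookup_subst_uminus:
  "lookup (subst (\<lambda>i. - Var i) p) m = (-1) ^ wt m * lookup p m"
proof -
  have "lookup (subst (\<lambda>i. - Var i) p) m =
      (\<Sum>k\<in>keys p. if k = m then (-1) ^ wt m * lookup p m else 0)"
    unfolding subst_def prod_uminus_Var_power Const_def mult_single lookup_sum
    by (intro sum.cong) (auto simp: lookup_single when_def)
  also have "\<dots> = (-1) ^ wt m * lookup p m"
    by (auto simp: in_keys_iff)
  finally show ?thesis .
qed

lemma eval_subst_uminus:
  "eval (subst (\<lambda>i. - Var i) p) v = eval p (\<lambda>i. - v i)"
proof -
  have k: "keys (subst (\<lambda>i. - Var i) p) = keys p"
    by (auto simp: in_keys_iff lookup_subst_uminus)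
  have "(\<Prod>i\<in>UNIV. (- v i) ^ lookup m i) = (-1) ^ wt m * (\<Prod>i\<in>UNIV. v i ^ lookup m i)" for m :: "'a composition"
    by (simp add: wt_def power_sum power_minus[of "v _"] prod.distrib)
  then show ?thesis
    unfolding eval_def k by (intro sum.cong) (auto simp: lookup_subst_uminus mult_ac)
qed

section \<open>The sorting permutation and a formula for the points\<close>

text \<open>This is the number of positions that the stable decreasing sort places after
  \<open>i\<close>, hence the entry of \<delta> that \<open>i\<close> receives.\<close>

definition colrank :: "'n::{finite,linorder} composition \<Rightarrow> 'n \<Rightarrow> nat" where
  "colrank \<gamma> i = card {k. lookup \<gamma> k < lookup \<gamma> i \<or> lookup \<gamma> k = lookup \<gamma> i \<and> i < k}"

lemma colrank_less_iff:
  "colrank \<gamma> i < colrank \<gamma> j \<longleftrightarrow>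
     lookup \<gamma> i < lookup \<gamma> j \<or> lookup \<gamma> i = lookup \<gamma> j \<and> j < i"
proof -
  have less: "colrank \<gamma> i < colrank \<gamma> j"
    if "lookup \<gamma> i < lookup \<gamma> j \<or> lookup \<gamma> i = lookup \<gamma> j \<and> j < i" for i j
    unfolding colrank_def using that by (intro psubset_card_mono) auto
  show ?thesis
    using less[of i j] less[of j i] by (metis less_asym linorder_less_linear)
qed

lemma inj_colrank: "inj (colrank \<gamma>)"
  by (rule injI) (metis colrank_less_iff less_irrefl neq_iff)

lemma colrank_less: "colrank (\<gamma> :: 'n::{finite,linorder} composition) i < card (UNIV :: 'n set)"
  unfolding colrank_def by (intro psubset_card_mono) auto

lemma \<delta>_less_iff: "\<delta> i < \<delta> j \<longleftrightarrow> j < i"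
proof -
  have less: "\<delta> i < \<delta> j" if "j < i" for i j :: 'a
    unfolding \<delta>_def using that by (intro psubset_card_mono) auto
  show ?thesis
    using less[of i j] less[of j i] by (metis less_asym linorder_less_linear)
qed

lemma bij_betw_\<delta>: "bij_betw \<delta> (UNIV :: 'n::{finite,linorder} set) {..<card (UNIV :: 'n set)}"
proof -
  have inj: "inj (\<delta> :: 'n \<Rightarrow> nat)"
    by (rule injI) (metis \<delta>_less_iff less_irrefl neq_iff)
  have "\<delta> (i :: 'n) < card (UNIV :: 'n set)" for i
    unfolding \<delta>_def by (intro psubset_card_mono) auto
  then have "range (\<delta> :: 'n \<Rightarrow> nat) = {..<card (UNIV :: 'n set)}"
    using inj by (intro card_subset_eq) (auto simp: card_image)
  with inj show ?thesis by (simp add: bij_betw_def)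
qed

text \<open>Both \<open>\<delta>\<close> and \<open>colrank \<gamma>\<close> are bijections onto the
  numbers below n, so \<open>w\<close> is the first followed by the inverse of the second.\<close>

lemma stable_sort_exists:
  fixes \<gamma> :: "'n::{finite,linorder} composition"
  shows "\<exists>w :: 'n \<Rightarrow> 'n. bij w \<and> (\<forall>i. \<delta> i = colrank \<gamma> (w i))"
proof -
  have "range (colrank \<gamma>) = {..<card (UNIV :: 'n set)}"
    using inj_colrank[of \<gamma>] colrank_less[of \<gamma>]
    by (intro card_subset_eq) (auto simp: card_image)
  then have bij: "bij_betw (colrank \<gamma>) UNIV {..<card (UNIV :: 'n set)}"
    by (simp add: bij_betw_def inj_colrank)
  have "bij (inv_into UNIV (colrank \<gamma>) \<circ> (\<delta> :: 'n \<Rightarrow> nat))"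
    using bij_betw_\<delta> bij_betw_inv_into[OF bij] by (rule bij_betw_trans)
  moreover have "\<delta> i = colrank \<gamma> ((inv_into UNIV (colrank \<gamma>) \<circ> (\<delta> :: 'n \<Rightarrow> nat)) i)" for i
  proof -
    have "\<delta> i \<in> range (colrank \<gamma>)"
      using bij_betw_apply[OF bij_betw_\<delta>, of i] bij by (simp add: bij_betw_def)
    then show ?thesis by (simp add: f_inv_into_f)
  qed
  ultimately show ?thesis by blast
qed

text \<open>Reindexing the inversions by their images under \<open>w\<close> turns them into pairs
  of positions of the unsorted vector, where different sorting permutations can be compared.\<close>

lemma perm_length_eq:
  assumes "bij w"
  shows "perm_length w = card {(a, b). b < a \<and> inv w a < inv w b}"
proof -
  have "bij_betw (map_prod w w) {(i, j). i < j \<and> w j < w i} {(a, b). b < a \<and> inv w a < inv w b}"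
    using assms
    by (intro bij_betw_byWitness[where f' = "map_prod (inv w) (inv w)"])
      (auto simp: bij_is_inj bij_is_surj surj_f_inv_f)
  then show ?thesis
    unfolding perm_length_def by (rule bij_betw_same_card)
qed

text \<open>
  Every sorting permutation inverts each pair \<open>b < a\<close> with \<open>\<gamma>\<^sub>b < \<gamma>\<^sub>a\<close>, and the stable one
  inverts no other pair; hence a shortest sorting permutation is stable.
\<close>

lemma \<delta>_inv_sorting_perm:
  fixes \<gamma> :: "'n::{finite,linorder} composition"
  shows "\<delta> (inv (sorting_perm \<gamma>) i) = colrank \<gamma> i"
proof -
  define P where "P = (\<lambda>w. bij w \<and> antimono (perm_act (inv w) (lookup \<gamma>)))"
  define I where "I = (\<lambda>w :: 'n \<Rightarrow> 'n. {(a, b). b < a \<and> inv w a < inv w b})"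
  define J where "J = {(a, b). b < a \<and> lookup \<gamma> b < lookup \<gamma> a}"
  have P_iff: "P w \<longleftrightarrow> bij w \<and> antimono (\<lambda>i. lookup \<gamma> (w i))" for w
    by (auto simp: P_def perm_act_def inv_inv_eq comp_def)
  have J_sub: "J \<subseteq> I w" if "P w" for w
  proof -
    have "inv w a < inv w b" if "lookup \<gamma> b < lookup \<gamma> a" for a b
    proof (rule ccontr)
      assume "\<not> ?thesis"
      then have "inv w b \<le> inv w a" by simp
      with \<open>P w\<close> have "lookup \<gamma> (w (inv w a)) \<le> lookup \<gamma> (w (inv w b))"
        unfolding P_iff by (auto dest: antimonoD)
      with \<open>P w\<close> that show False
        by (simp add: P_iff bij_is_surj surj_f_inv_f)
    qed
    then show ?thesis by (auto simp: I_def J_def)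
  qed
  obtain u :: "'n \<Rightarrow> 'n" where u: "bij u" "\<And>i. \<delta> i = colrank \<gamma> (u i)"
    using stable_sort_exists by blast
  have u_less: "i < j \<longleftrightarrow> colrank \<gamma> (u j) < colrank \<gamma> (u i)" for i j
    by (simp add: \<delta>_less_iff flip: u(2))
  have "antimono (\<lambda>i. lookup \<gamma> (u i))"
  proof (rule antimonoI)
    fix i j :: 'n assume "i \<le> j"
    then show "lookup \<gamma> (u j) \<le> lookup \<gamma> (u i)"
      using u_less[of i j] by (auto simp: le_less colrank_less_iff)
  qed
  then have "P u"
    unfolding P_iff using u(1) by blast
  moreover have "I u \<subseteq> J"
  proof
    fix p assume "p \<in> I u"
    then obtain a b where p: "p = (a, b)" "b < a" "inv u a < inv u b"
      by (auto simp: I_def)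
    then have "colrank \<gamma> b < colrank \<gamma> a"
      using u(1) by (simp add: u_less bij_is_surj surj_f_inv_f)
    then show "p \<in> J"
      using p(1,2) by (auto simp: J_def colrank_less_iff)
  qed
  ultimately have Iu: "I u = J"
    using J_sub by blast
  define w where "w = sorting_perm \<gamma>"
  have w: "P w" "perm_length w \<le> perm_length u"
    unfolding w_def sorting_perm_def
    using arg_min_nat_lemma[of P u perm_length] \<open>P u\<close> by (auto simp: P_def)
  have "perm_length v = card (I v)" if "P v" for v
    using that by (simp add: P_def I_def perm_length_eq)
  then have "card (I w) \<le> card J"
    using w \<open>P u\<close> Iu by simp
  \<comment> \<open>\<open>J\<close> lies in \<open>I w\<close>, and minimality bounds the size of
    \<open>I w\<close> by that of \<open>J\<close>.\<close>
  then have "I w = J"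
    using J_sub[OF w(1)] by (intro card_seteq[symmetric]) auto
  \<comment> \<open>Distinct entries are ordered by antimonotonicity; equal entries keep their order
    because such a pair is not in \<open>J\<close>.\<close>
  have *: "inv w i < inv w k \<longleftrightarrow> colrank \<gamma> k < colrank \<gamma> i" for i k
  proof -
    have less: "inv w i < inv w k" if "colrank \<gamma> k < colrank \<gamma> i" for i k
    proof (cases "lookup \<gamma> k < lookup \<gamma> i")
      case True
      show ?thesis
      proof (rule ccontr)
        assume "\<not> ?thesis"
        then have "inv w k \<le> inv w i" by simp
        with w(1) have "lookup \<gamma> (w (inv w i)) \<le> lookup \<gamma> (w (inv w k))"
          unfolding P_iff by (auto dest: antimonoD)
        with w(1) True show False
          by (simp add: P_iff bij_is_surj surj_f_inv_f)
      qed
    next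
      case False
      with that have "lookup \<gamma> k = lookup \<gamma> i" "i < k"
        by (auto simp: colrank_less_iff)
      then have "(k, i) \<notin> I w"
        by (simp add: \<open>I w = J\<close> J_def)
      with \<open>i < k\<close> have "\<not> inv w k < inv w i"
        by (simp add: I_def)
      moreover have "inv w k \<noteq> inv w i"
        using w(1) \<open>i < k\<close> by (metis P_iff bij_is_surj less_irrefl surj_f_inv_f)
      ultimately show ?thesis by auto
    qed
    show ?thesis
      using less[of i k] less[of k i]
      by (metis colrank_less_iff less_asym linorder_less_linear)
  qed
  \<comment> \<open>\<open>w\<close> carries the positions after \<open>inv w i\<close> to those of
    smaller rank, and the number of these is the rank itself.\<close>
  have "\<delta> (inv w i) = card (inv w ` {k. colrank \<gamma> k < colrank \<gamma> i})"
    unfolding \<delta>_def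
  proof (rule arg_cong[where f = card], safe)
    fix k assume "inv w i < k"
    then have "inv w i < inv w (w k)"
      using w(1) by (simp add: P_iff bij_is_inj)
    then show "k \<in> inv w ` {k. colrank \<gamma> k < colrank \<gamma> i}"
      using w(1) unfolding * by (intro image_eqI[of _ _ "w k"]) (simp_all add: P_iff bij_is_inj)
  qed (simp add: *)
  also have "\<dots> = card {k. colrank \<gamma> k < colrank \<gamma> i}"
    using w(1) by (intro card_image) (meson P_iff bij_imp_bij_inv bij_is_inj inj_on_subset subset_UNIV)
  also have "\<dots> = colrank \<gamma> i"
    by (simp add: colrank_less_iff) (simp add: colrank_def)
  finally show ?thesis by (simp add: w_def)
qed

text \<open>This removes the minimal permutation: the multiple of \<open>r\<close> depends only on
  how the other entries and positions compare with those at \<open>i\<close>.\<close>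

lemma bar_eq: "bar \<gamma> i = of_nat (lookup \<gamma> i) + r * of_nat (colrank \<gamma> i)"
  by (simp add: bar_def perm_act_def \<delta>_inv_sorting_perm)

section \<open>A linear order on compositions\<close>

text \<open>\<open>s < lookup \<eta> k\<close> says that the box \<open>(k, s)\<close> lies in
  \<open>\<eta>\<close>, columns being counted from 0. The pair \<open>(i, t)\<close> is the first
  box, by ascending column and then descending position, on which the two differ.\<close>

definition box_less :: "'n::{finite,linorder} composition \<Rightarrow> 'n composition \<Rightarrow> bool" where
  "box_less \<eta> \<gamma> \<longleftrightarrow> (\<exists>t i. lookup \<eta> i \<le> t \<and> t < lookup \<gamma> i \<and>
     (\<forall>s k. s < t \<or> s = t \<and> i < k \<longrightarrow> (s < lookup \<eta> k \<longleftrightarrow> s < lookup \<gamma> k)))"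

lemma box_less_irrefl: "\<not> box_less \<eta> \<eta>"
  by (auto simp: box_less_def)

lemma box_less_trans:
  assumes "box_less \<eta> \<gamma>" "box_less \<gamma> \<zeta>"
  shows "box_less \<eta> \<zeta>"
proof -
  obtain t i where h1: "lookup \<eta> i \<le> t" "t < lookup \<gamma> i"
    "\<And>s k. s < t \<or> s = t \<and> i < k \<Longrightarrow> s < lookup \<eta> k \<longleftrightarrow> s < lookup \<gamma> k"
    using assms(1) unfolding box_less_def by blast
  obtain u j where h2: "lookup \<gamma> j \<le> u" "u < lookup \<zeta> j"
    "\<And>s k. s < u \<or> s = u \<and> j < k \<Longrightarrow> s < lookup \<gamma> k \<longleftrightarrow> s < lookup \<zeta> k"
    using assms(2) unfolding box_less_def by blast
  \<comment> \<open>The earlier of the two boxes of first difference serves. They cannot coincide,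
    since that box would lie both inside and outside \<open>\<gamma>\<close>.\<close>
  consider "t < u \<or> t = u \<and> j < i" | "u < t \<or> t = u \<and> i < j" | "t = u" "i = j"
    by (meson linorder_less_linear)
  then show ?thesis
  proof cases
    case t: 1
    have "t < lookup \<zeta> i" using h2(3)[of t i] h1(2) t by auto
    moreover have "s < lookup \<eta> k \<longleftrightarrow> s < lookup \<zeta> k" if "s < t \<or> s = t \<and> i < k" for s k
    proof -
      have "s < u \<or> s = u \<and> j < k" using that t by auto
      from h1(3)[OF that] h2(3)[OF this] show ?thesis by (rule trans)
    qed
    ultimately show ?thesis
      unfolding box_less_def using h1(1) by blast
  next
    case t: 2
    have "lookup \<eta> j \<le> u" using h1(3)[of u j] h2(1) t by auto
    moreover have "s < lookup \<eta> k \<longleftrightarrow> s < lookup \<zeta> k" if "s < u \<or> s = u \<and> j < k" for s k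
    proof -
      have "s < t \<or> s = t \<and> i < k" using that t by auto
      from h1(3)[OF this] h2(3)[OF that] show ?thesis by (rule trans)
    qed
    ultimately show ?thesis
      unfolding box_less_def using h2(2) by blast
  next
    case 3
    with h1 h2 show ?thesis by auto
  qed
qed

lemma box_less_linear:
  assumes "\<eta> \<noteq> \<gamma>"
  shows "box_less \<eta> \<gamma> \<or> box_less \<gamma> \<eta>"
proof -
  define D where "D = (\<lambda>s k. (s < lookup \<eta> k) \<noteq> (s < lookup \<gamma> k))"
  obtain i where i: "lookup \<eta> i \<noteq> lookup \<gamma> i"
    using assms by (auto simp: poly_mapping_eq_iff fun_eq_iff)
  then have "D (min (lookup \<eta> i) (lookup \<gamma> i)) i"
    by (auto simp: D_def)
  then have ex: "\<exists>s k. D s k" by blast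
  \<comment> \<open>The first differing box is in the least differing column, at the last differing
    position there.\<close>
  define t where "t = (LEAST s. \<exists>k. D s k)"
  have t: "\<exists>k. D t k" unfolding t_def using ex by (rule LeastI_ex)
  have t_least: "\<not> D s k" if "s < t" for s k
    using not_less_Least[OF that[unfolded t_def]] by blast
  define i where "i = Max {k. D t k}"
  have "i \<in> {k. D t k}" unfolding i_def using t by (intro Max_in) auto
  moreover have "\<not> D t k" if "i < k" for k
  proof
    assume "D t k"
    then have "k \<le> i" unfolding i_def by (intro Max_ge) auto
    with that show False by simp
  qed
  ultimately have *: "D t i" "\<And>s k. s < t \<or> s = t \<and> i < k \<Longrightarrow> s < lookup \<eta> k \<longleftrightarrow> s < lookup \<gamma> k"
    using t_least by (auto simp: D_def)
  consider "lookup \<eta> i \<le> t" "t < lookup \<gamma> i" | "lookup \<gamma> i \<le> t" "t < lookup \<eta> i"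
    using *(1) by (force simp: D_def)
  then show ?thesis
  proof cases
    case 1
    with *(2) show ?thesis unfolding box_less_def by blast
  next
    case 2
    with *(2)[symmetric] show ?thesis unfolding box_less_def by blast
  qed
qed

text \<open>Provides the list along which the evaluation matrix is triangular.\<close>

lemma finite_box_sorted:
  assumes "finite C"
  shows "\<exists>xs. set xs = C \<and> distinct xs \<and> sorted_wrt box_less xs"
  using assms
proof (induction rule: finite_psubset_induct)
  case (psubset C)
  show ?case
  proof (cases "C = {}")
    case False
    obtain x where x: "x \<in> C" "\<And>y. y \<in> C \<Longrightarrow> \<not> box_less y x"
      using Finite_Set.bex_min_element[OF psubset.hyps(1) _ _ False, of box_less]
      by (metis asymp_onI box_less_irrefl box_less_trans transp_onI)
    then obtain xs where "set xs = C - {x}" "distinct xs" "sorted_wrt box_less xs"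
      using psubset.IH[of "C - {x}"] by blast
    then have "set (x # xs) = C \<and> distinct (x # xs) \<and> sorted_wrt box_less (x # xs)"
      using x box_less_linear by fastforce
    then show ?thesis by blast
  qed auto
qed

section \<open>Newton polynomials\<close>

text \<open>This is the value of \<open>bar \<gamma> i\<close> for any \<open>\<gamma>\<close> with
  entry \<open>t\<close> at \<open>i\<close> that agrees with \<open>\<eta>\<close> on all boxes
  read before \<open>(i, t)\<close>.\<close>

definition node :: "'n::{finite,linorder} composition \<Rightarrow> 'n \<Rightarrow> nat \<Rightarrow> ratfun" where
  "node \<eta> i t = of_nat t +
     r * of_nat (card {k. lookup \<eta> k < t \<or> lookup \<eta> k = t \<and> i < k})"

definition newton_factor :: "'n::{finite,linorder} composition \<Rightarrow> 'n \<Rightarrow> ratfun poly" where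
  "newton_factor \<eta> i = (\<Prod>t<lookup \<eta> i. [:- node \<eta> i t, 1:])"

definition divisors :: "'n composition \<Rightarrow> 'n composition set" where
  "divisors \<eta> = {m. \<forall>i. lookup m i \<le> lookup \<eta> i}"

text \<open>The product over \<open>i\<close> of \<open>newton_factor \<eta> i\<close> in the
  variable \<open>x_i\<close>, stored in expanded form so that its coefficients are
  immediate.\<close>

definition newton :: "'n::{finite,linorder} composition \<Rightarrow> 'n mpoly" where
  "newton \<eta> = (\<Sum>m\<in>divisors \<eta>.
     Poly_Mapping.single m (\<Prod>i\<in>UNIV. coeff (newton_factor \<eta> i) (lookup m i)))"

lemma bij_betw_divisors:
  "bij_betw lookup (divisors \<eta>) (PiE UNIV (\<lambda>i :: 'n::finite. {..lookup \<eta> i}))"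
  unfolding divisors_def
  by (rule bij_betw_byWitness[where f' = Abs_poly_mapping]) (auto simp: lookup_inverse)

lemma finite_divisors: "finite (divisors (\<eta> :: 'n::finite composition))"
  using bij_betw_finite[OF bij_betw_divisors, of \<eta>] by (simp add: finite_PiE)

lemma finite_wt_le: "finite {\<eta> :: 'n::finite composition. wt \<eta> \<le> d}"
proof (rule finite_subset)
  have "lookup \<eta> i \<le> wt \<eta>" for \<eta> :: "'n composition" and i
    unfolding wt_def by (intro member_le_sum) auto
  then show "{\<eta> :: 'n composition. wt \<eta> \<le> d} \<subseteq> divisors (Abs_poly_mapping (\<lambda>_. d))"
    by (auto simp: divisors_def intro: order_trans)
qed (rule finite_divisors)

text \<open>Its use: \<open>newton \<eta>\<close> has a single monomial of top weight, that of
  \<open>\<eta>\<close>.\<close>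

lemma wt_less_if_divisor:
  assumes "m \<in> divisors \<eta>" "m \<noteq> \<eta>"
  shows "wt m < wt (\<eta> :: 'n::finite composition)"
proof -
  obtain i where "lookup m i \<noteq> lookup \<eta> i"
    using assms(2) by (auto simp: poly_mapping_eq_iff fun_eq_iff)
  moreover have "lookup m k \<le> lookup \<eta> k" for k
    using assms(1) by (simp add: divisors_def)
  ultimately show ?thesis
    unfolding wt_def by (intro sum_strict_mono_ex1) (auto intro!: bexI[of _ i] simp: less_le)
qed

lemma lookup_newton:
  "lookup (newton \<eta>) m =
     (if m \<in> divisors \<eta> then \<Prod>i\<in>UNIV. coeff (newton_factor \<eta> i) (lookup m i) else 0)"
proof -
  have "lookup (newton \<eta>) m = (\<Sum>k\<in>divisors \<eta>.
      if k = m then \<Prod>i\<in>UNIV. coeff (newton_factor \<eta> i) (lookup m i) else 0)"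
    unfolding newton_def lookup_sum by (intro sum.cong) (auto simp: lookup_single when_def)
  then show ?thesis by (simp add: finite_divisors)
qed

lemma degree_newton_factor: "degree (newton_factor \<eta> i) = lookup \<eta> i"
  by (simp add: newton_factor_def degree_prod_eq_sum_degree)

lemma lookup_newton_self: "lookup (newton \<eta>) \<eta> = 1"
proof -
  have "coeff (newton_factor \<eta> i) (lookup \<eta> i) = lead_coeff (newton_factor \<eta> i)" for i
    by (simp add: degree_newton_factor)
  also have "\<dots> i = 1" for i
    by (simp add: newton_factor_def lead_coeff_prod)
  finally show ?thesis by (simp add: lookup_newton divisors_def)
qed

text \<open>Expanding the product of univariate sums means choosing an exponent for every variable,
  that is, a divisor.\<close>

lemma eval_newton: "eval (newton \<eta>) v = (\<Prod>i\<in>UNIV. \<Prod>t<lookup \<eta> i. v i - node \<eta> i t)"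
proof -
  have "eval (newton \<eta>) v = (\<Sum>m\<in>divisors \<eta>. \<Prod>i\<in>UNIV. coeff (newton_factor \<eta> i) (lookup m i) * v i ^ lookup m i)"
    by (subst eval_superset[of "divisors \<eta>"])
      (auto simp: finite_divisors lookup_newton in_keys_iff prod.distrib split: if_splits)
  also have "\<dots> = (\<Sum>g\<in>PiE UNIV (\<lambda>i. {..lookup \<eta> i}). \<Prod>i\<in>UNIV. coeff (newton_factor \<eta> i) (g i) * v i ^ g i)"
    by (rule sum.reindex_bij_betw[OF bij_betw_divisors])
  also have "\<dots> = (\<Prod>i\<in>UNIV. \<Sum>k\<le>lookup \<eta> i. coeff (newton_factor \<eta> i) k * v i ^ k)"
    by (simp add: prod_sum_PiE)
  also have "\<dots> = (\<Prod>i\<in>UNIV. poly (newton_factor \<eta> i) (v i))"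
    by (simp add: poly_altdef degree_newton_factor)
  finally show ?thesis by (simp add: newton_factor_def poly_prod)
qed

text \<open>Each factor has the form \<open>a + r b\<close> with naturals \<open>a > 0\<close> and
  \<open>b\<close>, because the positions counted by the node are among those counted by
  \<open>colrank\<close>.\<close>

lemma eval_newton_self: "eval (newton \<eta>) (bar \<eta>) \<noteq> 0"
proof
  assume "eval (newton \<eta>) (bar \<eta>) = 0"
  then obtain i t where t: "t < lookup \<eta> i" "bar \<eta> i = node \<eta> i t"
    by (auto simp: eval_newton)
  have "card {k. lookup \<eta> k < t \<or> lookup \<eta> k = t \<and> i < k} \<le> colrank \<eta> i"
    unfolding colrank_def using t(1) by (intro card_mono) auto
  then have "bar \<eta> i - node \<eta> i t = of_nat (lookup \<eta> i - t) +
      r * of_nat (colrank \<eta> i - card {k. lookup \<eta> k < t \<or> lookup \<eta> k = t \<and> i < k})"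
    using t(1) by (simp add: bar_eq node_def of_nat_diff algebra_simps)
  also have "\<dots> \<noteq> 0"
    unfolding of_nat_add_r_eq_0_iff using t(1) by simp
  finally show False using t(2) by simp
qed

lemma eval_newton_eq_0:
  assumes "box_less \<gamma> \<eta>"
  shows "eval (newton \<eta>) (bar \<gamma>) = 0"
proof -
  obtain t i where ti: "lookup \<gamma> i \<le> t" "t < lookup \<eta> i"
    and agree: "\<And>s k. s < t \<or> s = t \<and> i < k \<Longrightarrow> s < lookup \<gamma> k \<longleftrightarrow> s < lookup \<eta> k"
    using assms unfolding box_less_def by blast
  \<comment> \<open>Column \<open>t - 1\<close> tells whether an entry is below \<open>t\<close>;
    for \<open>t = 0\<close> no entry is.\<close>
  have less_t: "lookup \<gamma> k < t \<longleftrightarrow> lookup \<eta> k < t" for k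
  proof (cases t)
    case (Suc s)
    with agree[of s k] show ?thesis by auto
  qed simp
  have "lookup \<gamma> i = t"
    using less_t[of i] ti by linarith
  moreover have "lookup \<gamma> k = t \<longleftrightarrow> lookup \<eta> k = t" if "i < k" for k
    using agree[of t k] less_t[of k] that by linarith
  ultimately have "{k. lookup \<gamma> k < lookup \<gamma> i \<or> lookup \<gamma> k = lookup \<gamma> i \<and> i < k} =
      {k. lookup \<eta> k < t \<or> lookup \<eta> k = t \<and> i < k}"
    using less_t by auto
  then have "bar \<gamma> i = node \<eta> i t"
    using \<open>lookup \<gamma> i = t\<close> by (simp add: bar_eq node_def colrank_def)
  then show ?thesis
    using ti(2) by (auto simp: eval_newton)
qed

section \<open>Lagrange bases\<close>

text \<open>Interpolation is linear and, by hypothesis, fixes the Newton polynomials. A monomial is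
  a Newton polynomial minus a combination of monomials of smaller weight, so induction on the weight
  applies.\<close>

lemma interp_expansion_monomial:
  assumes newton: "\<And>\<eta> :: 'n::{finite,linorder} composition. wt \<eta> \<le> d \<Longrightarrow>
      newton \<eta> = (\<Sum>\<gamma> | wt \<gamma> \<le> d. scale (eval (newton \<eta>) (bar \<gamma>)) (e \<gamma>))"
    and "wt (\<eta> :: 'n composition) \<le> d"
  shows "Poly_Mapping.single \<eta> 1 =
    (\<Sum>\<gamma> | wt \<gamma> \<le> d. scale (eval (Poly_Mapping.single \<eta> 1) (bar \<gamma>)) (e \<gamma>))"
  using \<open>wt \<eta> \<le> d\<close>
proof (induction "wt \<eta>" arbitrary: \<eta> rule: less_induct)
  case less
  let ?x = "\<lambda>m :: 'n composition. Poly_Mapping.single m 1 :: 'n mpoly"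
  define S where "S = divisors \<eta> - {\<eta>}"
  have S: "finite S" "\<And>m. m \<in> S \<Longrightarrow> wt m < wt \<eta>"
    by (auto simp: S_def finite_divisors wt_less_if_divisor)
  have x_eq: "?x \<eta> = newton \<eta> - (\<Sum>m\<in>S. scale (lookup (newton \<eta>) m) (?x m))"
  proof (rule poly_mapping_eqI)
    fix k
    have "lookup (\<Sum>m\<in>S. scale (lookup (newton \<eta>) m) (?x m)) k =
        (\<Sum>m\<in>S. if m = k then lookup (newton \<eta>) k else 0)"
      unfolding lookup_sum by (intro sum.cong) (auto simp: lookup_single when_def)
    also have "\<dots> = (if k \<in> S then lookup (newton \<eta>) k else 0)"
      using S(1) by simp
    finally have *: "lookup (\<Sum>m\<in>S. scale (lookup (newton \<eta>) m) (?x m)) k = \<dots>" .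
    show "lookup (?x \<eta>) k =
        lookup (newton \<eta> - (\<Sum>m\<in>S. scale (lookup (newton \<eta>) m) (?x m))) k"
      unfolding lookup_minus *
      by (auto simp: S_def lookup_single when_def lookup_newton_self) (simp add: lookup_newton)
  qed
  define X where "X = (\<lambda>p :: 'n mpoly. \<Sum>\<gamma> | wt \<gamma> \<le> d. scale (eval p (bar \<gamma>)) (e \<gamma>))"
  have X_diff: "X (p - q) = X p - X q" for p q
    by (simp add: X_def eval_diff scale.scale_left_diff_distrib sum_subtractf)
  have X_scale: "X (scale c p) = scale c (X p)" for c p
    by (simp add: X_def eval_scale scale.scale_sum_right)
  have X_sum: "X (\<Sum>m\<in>S. p m) = (\<Sum>m\<in>S. X (p m))" for p
    unfolding X_def eval_sum scale.scale_sum_left by (rule sum.swap)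
  have "X (?x \<eta>) = X (newton \<eta>) - (\<Sum>m\<in>S. scale (lookup (newton \<eta>) m) (X (?x m)))"
    by (subst x_eq) (simp add: X_diff X_sum X_scale)
  also have "X (newton \<eta>) = newton \<eta>"
    using newton[OF less.prems] by (simp add: X_def)
  also have "(\<Sum>m\<in>S. scale (lookup (newton \<eta>) m) (X (?x m))) =
      (\<Sum>m\<in>S. scale (lookup (newton \<eta>) m) (?x m))"
    using less.hyps S(2) less.prems
    by (intro sum.cong refl) (simp add: X_def less_imp_le order_less_le_trans)
  finally show ?case using x_eq by (simp add: X_def)
qed

lemma poly_eq_sum_monomials: "p = (\<Sum>m\<in>keys p. scale (lookup p m) (Poly_Mapping.single m 1))"
proof (rule poly_mapping_eqI)
  fix k
  have "lookup (\<Sum>m\<in>keys p. scale (lookup p m) (Poly_Mapping.single m 1)) k =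
      (\<Sum>m\<in>keys p. if m = k then lookup p k else 0)"
    unfolding lookup_sum by (intro sum.cong) (auto simp: lookup_single when_def)
  then show "lookup p k = lookup (\<Sum>m\<in>keys p. scale (lookup p m) (Poly_Mapping.single m 1)) k"
    by (simp add: in_keys_iff)
qed

text \<open>The third clause makes the normalisation in \<open>E_interp\<close> possible; the fourth
  is completeness of the points for degree at most \<open>d\<close>.\<close>

definition is_lagrange_basis ::
    "nat \<Rightarrow> ('n::{finite,linorder} composition \<Rightarrow> 'n mpoly) \<Rightarrow> bool" where
  "is_lagrange_basis d e \<longleftrightarrow>
     (\<forall>\<eta> m. d < wt m \<longrightarrow> lookup (e \<eta>) m = 0) \<and>
     (\<forall>\<eta> \<gamma>. wt \<eta> \<le> d \<longrightarrow> wt \<gamma> \<le> d \<longrightarrow> eval (e \<eta>) (bar \<gamma>) = of_bool (\<eta> = \<gamma>)) \<and>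
     (\<forall>\<eta>. wt \<eta> = d \<longrightarrow> lookup (e \<eta>) \<eta> \<noteq> 0) \<and>
     (\<forall>p. (\<forall>m. d < wt m \<longrightarrow> lookup p m = 0) \<longrightarrow>
       p = (\<Sum>\<gamma> | wt \<gamma> \<le> d. scale (eval p (bar \<gamma>)) (e \<gamma>)))"

lemma is_lagrange_basisD:
  assumes "is_lagrange_basis d e"
  shows "d < wt m \<Longrightarrow> lookup (e \<eta>) m = 0"
    and "wt \<eta> \<le> d \<Longrightarrow> wt \<gamma> \<le> d \<Longrightarrow> eval (e \<eta>) (bar \<gamma>) = of_bool (\<eta> = \<gamma>)"
    and "wt \<eta> = d \<Longrightarrow> lookup (e \<eta>) \<eta> \<noteq> 0"
    and "(\<And>m. d < wt m \<Longrightarrow> lookup p m = 0) \<Longrightarrow>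
      p = (\<Sum>\<gamma> | wt \<gamma> \<le> d. scale (eval p (bar \<gamma>)) (e \<gamma>))"
  using assms unfolding is_lagrange_basis_def by blast+

lemma lagrange_basis_exists:
  "\<exists>e :: 'n::{finite,linorder} composition \<Rightarrow> 'n mpoly. is_lagrange_basis d e"
proof -
  define C where "C = {\<eta> :: 'n composition. wt \<eta> \<le> d}"
  have fin: "finite C" by (simp add: C_def finite_wt_le)
  define M where "M = (\<lambda>\<eta> \<gamma> :: 'n composition. eval (newton \<eta>) (bar \<gamma>))"
  obtain xs where xs: "set xs = C" "distinct xs" "sorted_wrt box_less xs"
    using finite_box_sorted[OF fin] by blast
  have "sorted_wrt (\<lambda>\<eta> \<gamma>. M \<gamma> \<eta> = 0) xs"
    using xs(3) by (rule sorted_wrt_mono_rel[rotated]) (simp add: M_def eval_newton_eq_0)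
  then obtain B where B: "\<And>\<eta>. \<eta> \<in> C \<Longrightarrow> B \<eta> \<eta> \<noteq> 0"
    "\<And>\<eta> \<gamma>. \<eta> \<in> C \<Longrightarrow> \<gamma> \<in> C \<Longrightarrow> (\<Sum>\<zeta>\<in>C. M \<eta> \<zeta> * B \<zeta> \<gamma>) = of_bool (\<eta> = \<gamma>)"
    "\<And>\<eta> \<gamma>. \<eta> \<in> C \<Longrightarrow> \<gamma> \<in> C \<Longrightarrow> (\<Sum>\<zeta>\<in>C. B \<eta> \<zeta> * M \<zeta> \<gamma>) = of_bool (\<eta> = \<gamma>)"
    using triangular_inverse[of xs M] xs(1,2) by (auto simp: M_def eval_newton_self)
  \<comment> \<open>The rows of \<open>B\<close> combine the Newton polynomials:
    \<open>B M = 1\<close> gives duality at the points, and \<open>M B = 1\<close> expands each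
    Newton polynomial in the \<open>e \<gamma>\<close>.\<close>
  define e where "e = (\<lambda>\<eta>. \<Sum>\<zeta>\<in>C. scale (B \<eta> \<zeta>) (newton \<zeta>))"
  have lookup_0: "lookup (newton \<zeta>) m = 0" if "wt \<zeta> \<le> wt m" "\<zeta> \<noteq> m" for \<zeta> m :: "'n composition"
    using that wt_less_if_divisor[of m \<zeta>] by (auto simp: lookup_newton)
  have newton: "newton \<eta> = (\<Sum>\<gamma> | wt \<gamma> \<le> d. scale (eval (newton \<eta>) (bar \<gamma>)) (e \<gamma>))"
    if "wt \<eta> \<le> d" for \<eta>
  proof -
    have \<eta>: "\<eta> \<in> C" using that by (simp add: C_def)
    have "(\<Sum>\<gamma>\<in>C. scale (M \<eta> \<gamma>) (e \<gamma>)) = (\<Sum>\<zeta>\<in>C. scale (\<Sum>\<gamma>\<in>C. M \<eta> \<gamma> * B \<gamma> \<zeta>) (newton \<zeta>))"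
      unfolding e_def scale.scale_sum_right scale.scale_sum_left scale.scale_scale
      by (rule sum.swap)
    also have "\<dots> = (\<Sum>\<zeta>\<in>C. if \<eta> = \<zeta> then newton \<zeta> else 0)"
      using \<eta> by (intro sum.cong) (auto simp: B(2))
    also have "\<dots> = newton \<eta>"
      using \<eta> fin by simp
    finally show ?thesis by (simp add: M_def C_def)
  qed
  have "is_lagrange_basis d e"
    unfolding is_lagrange_basis_def
  proof (intro conjI allI impI)
    fix \<eta> m :: "'n composition" assume "d < wt m"
    then show "lookup (e \<eta>) m = 0"
      unfolding e_def lookup_sum by (intro sum.neutral) (auto simp: C_def intro!: lookup_0)
  next
    fix \<eta> \<gamma> :: "'n composition" assume "wt \<eta> \<le> d" "wt \<gamma> \<le> d"
    then show "eval (e \<eta>) (bar \<gamma>) = of_bool (\<eta> = \<gamma>)"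
      using B(3)[of \<eta> \<gamma>] by (simp add: e_def eval_sum eval_scale M_def C_def)
  next
    fix \<eta> :: "'n composition" assume \<eta>: "wt \<eta> = d"
    \<comment> \<open>In top weight \<open>d\<close> only \<open>newton \<eta>\<close> contributes
      to this coefficient, so a diagonal entry of \<open>B\<close> remains.\<close>
    have "lookup (e \<eta>) \<eta> = (\<Sum>\<zeta>\<in>C. if \<zeta> = \<eta> then B \<eta> \<eta> else 0)"
      unfolding e_def lookup_sum using \<eta>
      by (intro sum.cong) (auto simp: lookup_newton_self lookup_0 C_def)
    also have "\<dots> = B \<eta> \<eta>"
      using \<eta> fin by (simp add: C_def)
    finally show "lookup (e \<eta>) \<eta> \<noteq> 0"
      using B(1)[of \<eta>] \<eta> by (simp add: C_def)
  next
    fix p :: "'n mpoly" assume p: "\<forall>m. d < wt m \<longrightarrow> lookup p m = 0"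
    let ?x = "\<lambda>m :: 'n composition. Poly_Mapping.single m 1 :: 'n mpoly"
    have keys: "wt m \<le> d" if "m \<in> keys p" for m
      using that p by (cases "d < wt m") (auto simp: in_keys_iff)
    have "(\<Sum>\<gamma>\<in>C. scale (eval p (bar \<gamma>)) (e \<gamma>)) =
        (\<Sum>\<gamma>\<in>C. scale (\<Sum>m\<in>keys p. lookup p m * eval (?x m) (bar \<gamma>)) (e \<gamma>))"
      by (subst (1) poly_eq_sum_monomials[of p]) (simp only: eval_sum eval_scale)
    also have "\<dots> = (\<Sum>m\<in>keys p. scale (lookup p m) (\<Sum>\<gamma>\<in>C. scale (eval (?x m) (bar \<gamma>)) (e \<gamma>)))"
      unfolding scale.scale_sum_right scale.scale_sum_left scale.scale_scale
      by (rule sum.swap)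
    also have "\<dots> = (\<Sum>m\<in>keys p. scale (lookup p m) (?x m))"
      using interp_expansion_monomial[OF newton] keys
      by (intro sum.cong refl arg_cong2[of _ _ _ _ scale]) (simp add: C_def)
    also have "\<dots> = p" by (rule poly_eq_sum_monomials[symmetric])
    finally show "p = (\<Sum>\<gamma> | wt \<gamma> \<le> d. scale (eval p (bar \<gamma>)) (e \<gamma>))"
      by (simp add: C_def)
  qed
  then show ?thesis by blast
qed

lemma poly_eq_0_if_vanishing:
  assumes "\<And>m. d < wt m \<Longrightarrow> lookup p m = 0" "\<And>\<gamma>. wt \<gamma> \<le> d \<Longrightarrow> eval p (bar \<gamma>) = 0"
  shows "p = 0"
proof -
  obtain e :: "'a composition \<Rightarrow> 'a mpoly" where "is_lagrange_basis d e"
    using lagrange_basis_exists by blast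
  from is_lagrange_basisD(4)[OF this assms(1)] show "p = 0"
    by (simp add: assms(2))
qed

section \<open>Interpolation polynomials and the span of the \<open>F_jack \<eta>\<close>\<close>

lemma E_interp_eq:
  assumes "is_lagrange_basis (wt \<eta>) e"
  shows "E_interp \<eta> = scale (1 / lookup (e \<eta>) \<eta>) (e \<eta>)"
  unfolding E_interp_def
proof (rule the_equality, safe)
  note e = is_lagrange_basisD[OF assms]
  let ?p = "scale (1 / lookup (e \<eta>) \<eta>) (e \<eta>)"
  show "deg ?p = ereal (real (wt \<eta>))"
  proof (rule antisym)
    show "deg ?p \<le> ereal (real (wt \<eta>))"
      using e(1) by (simp add: deg_le_iff)
    show "ereal (real (wt \<eta>)) \<le> deg ?p"
      unfolding deg_def using e(3)[OF refl] by (intro SUP_upper) (simp add: in_keys_iff)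
  qed
  show "eval ?p (bar \<gamma>) = 0" if "\<gamma> \<noteq> \<eta>" "wt \<gamma> \<le> wt \<eta>" for \<gamma>
    using that e(2) by (simp add: eval_scale)
  show "lookup ?p \<eta> = 1"
    using e(3)[OF refl] by simp
  fix q
  assume q: "deg q = ereal (real (wt \<eta>))" "lookup q \<eta> = 1"
    "\<forall>\<gamma>. \<gamma> \<noteq> \<eta> \<and> wt \<gamma> \<le> wt \<eta> \<longrightarrow> eval q (bar \<gamma>) = 0"
  \<comment> \<open>A competitor \<open>q\<close> agrees with \<open>scale c (e \<eta>)\<close> at
    every point of weight at most \<open>wt \<eta>\<close>, so it equals it; the normalisation then
    fixes \<open>c\<close>.\<close>
  define c where "c = eval q (bar \<eta>)"
  have q_lookup: "lookup q m = 0" if "wt \<eta> < wt m" for m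
    using that q(1) deg_le_iff[of q "wt \<eta>"] by auto
  have "q - scale c (e \<eta>) = 0"
  proof (rule poly_eq_0_if_vanishing)
    show "lookup (q - scale c (e \<eta>)) m = 0" if "wt \<eta> < wt m" for m
      using that q_lookup e(1) by (simp add: lookup_minus)
    show "eval (q - scale c (e \<eta>)) (bar \<gamma>) = 0" if "wt \<gamma> \<le> wt \<eta>" for \<gamma>
      using that q(3) e(2) by (cases "\<gamma> = \<eta>") (auto simp: eval_diff eval_scale c_def)
  qed
  then have q_eq: "q = scale c (e \<eta>)" by simp
  with q(2) have "c = 1 / lookup (e \<eta>) \<eta>"
    using e(3)[OF refl] by (simp add: field_simps)
  with q_eq show "q = ?p" by simp
qed

lemma lookup_E_interp_eq_0:
  fixes \<eta> m :: "'n::{finite,linorder} composition"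
  assumes "wt \<eta> < wt m"
  shows "lookup (E_interp \<eta>) m = 0"
proof -
  obtain e :: "'n composition \<Rightarrow> 'n mpoly" where e: "is_lagrange_basis (wt \<eta>) e"
    using lagrange_basis_exists by blast
  show ?thesis
    using is_lagrange_basisD(1)[OF e assms] by (simp add: E_interp_eq[OF e])
qed

lemma eval_E_interp_eq_0:
  fixes \<eta> \<gamma> :: "'n::{finite,linorder} composition"
  assumes "\<gamma> \<noteq> \<eta>" "wt \<gamma> \<le> wt \<eta>"
  shows "eval (E_interp \<eta>) (bar \<gamma>) = 0"
proof -
  obtain e :: "'n composition \<Rightarrow> 'n mpoly" where e: "is_lagrange_basis (wt \<eta>) e"
    using lagrange_basis_exists by blast
  show ?thesis
    using is_lagrange_basisD(2)[OF e order_refl assms(2)] assms(1)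
    by (simp add: E_interp_eq[OF e] eval_scale)
qed

lemma lookup_F_jack:
  "lookup (F_jack \<eta>) m = hook \<eta> * (lookup (E_interp \<eta>) m when wt m = wt \<eta>)"
  by (simp add: F_jack_def E_jack_def lookup_hom_component)

lemma homogeneous_iff: "homogeneous d f \<longleftrightarrow> (\<forall>m. wt m \<noteq> d \<longrightarrow> lookup f m = 0)"
  by (auto simp: homogeneous_def in_keys_iff)

lemma homogeneous_F_jack: "homogeneous (wt \<eta>) (F_jack \<eta>)"
  by (simp add: homogeneous_iff lookup_F_jack)

text \<open>
  Subtracting the interpolant of degree \<open>< d\<close> of \<open>f\<close> leaves the top component unchanged and
  makes the difference a combination of the \<open>E_interp \<eta>\<close> with \<open>wt \<eta> = d\<close>.
\<close>

lemma homogeneous_F_jack_expansion: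
  fixes f :: "'n::{finite,linorder} mpoly"
  assumes f: "homogeneous d f"
  obtains c where "f = (\<Sum>\<eta> | wt \<eta> = d. scale (c \<eta>) (F_jack \<eta>))"
proof -
  obtain e :: "'n composition \<Rightarrow> 'n mpoly" where e_basis: "is_lagrange_basis d e"
    using lagrange_basis_exists by blast
  note e = is_lagrange_basisD[OF e_basis]
  have e_eq: "e \<eta> = scale (lookup (e \<eta>) \<eta>) (E_interp \<eta>)" if "wt \<eta> = d" for \<eta>
    using that e(3)[of \<eta>] e_basis by (simp add: E_interp_eq)
  \<comment> \<open>\<open>g\<close> interpolates \<open>f\<close> at the points of weight below
    \<open>d\<close>; for \<open>d = 0\<close> there are none and \<open>g = 0\<close>
    serves.\<close>
  obtain g where g: "\<And>m. d \<le> wt m \<Longrightarrow> lookup g m = 0"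
    "\<And>\<gamma>. wt \<gamma> < d \<Longrightarrow> eval g (bar \<gamma>) = eval f (bar \<gamma>)"
  proof (cases d)
    case 0
    then show ?thesis using that[of 0] by simp
  next
    case (Suc k)
    obtain e' :: "'n composition \<Rightarrow> 'n mpoly" where "is_lagrange_basis k e'"
      using lagrange_basis_exists by blast
    note e' = is_lagrange_basisD[OF this]
    show ?thesis
    proof (rule that[of "\<Sum>\<eta> | wt \<eta> \<le> k. scale (eval f (bar \<eta>)) (e' \<eta>)"])
      fix m :: "'n composition" assume "d \<le> wt m"
      then show "lookup (\<Sum>\<eta> | wt \<eta> \<le> k. scale (eval f (bar \<eta>)) (e' \<eta>)) m = 0"
        using Suc by (simp add: lookup_sum e'(1))
    next
      fix \<gamma> :: "'n composition" assume "wt \<gamma> < d"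
      then have \<gamma>: "wt \<gamma> \<le> k" using Suc by simp
      have "eval (\<Sum>\<eta> | wt \<eta> \<le> k. scale (eval f (bar \<eta>)) (e' \<eta>)) (bar \<gamma>) =
          (\<Sum>\<eta> | wt \<eta> \<le> k. if \<eta> = \<gamma> then eval f (bar \<gamma>) else 0)"
        unfolding eval_sum eval_scale using \<gamma> by (intro sum.cong) (auto simp: e'(2))
      then show "eval (\<Sum>\<eta> | wt \<eta> \<le> k. scale (eval f (bar \<eta>)) (e' \<eta>)) (bar \<gamma>) = eval f (bar \<gamma>)"
        using \<gamma> by (simp add: finite_wt_le)
    qed
  qed
  have "f - g = (\<Sum>\<gamma> | wt \<gamma> \<le> d. scale (eval (f - g) (bar \<gamma>)) (e \<gamma>))"
    using f by (intro e(4)) (simp add: lookup_minus g(1) homogeneous_iff)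
  also have "\<dots> = (\<Sum>\<gamma> | wt \<gamma> = d. scale (eval (f - g) (bar \<gamma>)) (e \<gamma>))"
    using g(2) by (intro sum.mono_neutral_right finite_wt_le) (auto simp: eval_diff)
  also have "\<dots> = (\<Sum>\<gamma> | wt \<gamma> = d. scale (eval (f - g) (bar \<gamma>) * lookup (e \<gamma>) \<gamma>) (E_interp \<gamma>))"
    by (intro sum.cong refl) (simp, subst e_eq, simp_all)
  finally have fg: "f - g = \<dots>" .
  \<comment> \<open>Division by \<open>hook \<gamma>\<close> compensates the factor contained in
    \<open>F_jack \<gamma>\<close>.\<close>
  define c where "c = (\<lambda>\<gamma>. eval (f - g) (bar \<gamma>) * lookup (e \<gamma>) \<gamma> / hook \<gamma>)"
  show ?thesis
  proof (rule that[of c], rule poly_mapping_eqI)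
    fix m
    show "lookup f m = lookup (\<Sum>\<eta> | wt \<eta> = d. scale (c \<eta>) (F_jack \<eta>)) m"
    proof (cases "wt m = d")
      case True
      then have "lookup f m = lookup (f - g) m"
        by (simp add: lookup_minus g(1))
      also have "\<dots> = (\<Sum>\<gamma> | wt \<gamma> = d. eval (f - g) (bar \<gamma>) * lookup (e \<gamma>) \<gamma> * lookup (E_interp \<gamma>) m)"
        using arg_cong[OF fg, of "\<lambda>p. lookup p m"] by (simp only: lookup_sum lookup_scale)
      also have "\<dots> = lookup (\<Sum>\<eta> | wt \<eta> = d. scale (c \<eta>) (F_jack \<eta>)) m"
        unfolding lookup_sum using True
        by (intro sum.cong refl) (simp add: lookup_F_jack c_def hook_neq_0)
      finally show ?thesis .
    next
      case False
      then show ?thesis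
        using f by (simp add: homogeneous_iff lookup_sum lookup_F_jack)
    qed
  qed
qed

section \<open>Lifts and the operator \<open>\<Xi>\<close>\<close>

text \<open>Conditions (1) and (2) as a relation, to be carried through linear combinations. The
  degree is a separate argument because the zero polynomial is homogeneous of every degree.\<close>

definition is_lift :: "nat \<Rightarrow> 'n::{finite,linorder} mpoly \<Rightarrow> 'n mpoly \<Rightarrow> bool" where
  "is_lift d f g \<longleftrightarrow> deg (g - f) < ereal (real d) \<and>
     (\<forall>\<eta>. wt \<eta> < d \<longrightarrow> eval g (\<lambda>i. - bar \<eta> i) = 0)"

lemma is_lift_iff:
  "is_lift d f g \<longleftrightarrow> (\<forall>m. d \<le> wt m \<longrightarrow> lookup g m = lookup f m) \<and>
     (\<forall>\<eta>. wt \<eta> < d \<longrightarrow> eval g (\<lambda>i. - bar \<eta> i) = 0)"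
  by (simp add: is_lift_def deg_less_iff lookup_minus)

text \<open>The difference of two lifts has degree below \<open>d\<close>, and reflection in the
  origin moves its zeros to the points \<open>bar \<eta>\<close> with \<open>wt \<eta> < d\<close>;
  vanishing in degree \<open>d - 1\<close> then applies. For \<open>d = 0\<close> all coefficients
  already agree.\<close>

lemma is_lift_unique:
  assumes "is_lift d f g" "is_lift d f h"
  shows "g = h"
proof (cases d)
  case 0
  with assms show ?thesis
    by (intro poly_mapping_eqI) (simp add: is_lift_iff)
next
  case (Suc k)
  have "subst (\<lambda>i. - Var i) (g - h) = 0"
    using assms Suc
    by (intro poly_eq_0_if_vanishing[of k])
      (simp_all add: is_lift_iff lookup_subst_uminus eval_subst_uminus lookup_minus eval_diff)
  then have "lookup (g - h) m = 0" for m
    using lookup_subst_uminus[of "g - h" m] by simp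
  then show ?thesis
    by (intro poly_mapping_eqI) (simp add: lookup_minus)
qed

lemma is_lift_sum:
  assumes "\<And>a. a \<in> A \<Longrightarrow> is_lift d (f a) (g a)"
  shows "is_lift d (\<Sum>a\<in>A. scale (c a) (f a)) (\<Sum>a\<in>A. scale (c a) (g a))"
  using assms by (auto simp: is_lift_iff lookup_sum eval_sum eval_scale intro!: sum.cong sum.neutral)

text \<open>In top weight the sign in \<open>F_interp\<close> cancels the sign of the reflection,
  and evaluation at \<open>- bar \<gamma>\<close> undoes the reflection.\<close>

lemma is_lift_F: "wt \<eta> = d \<Longrightarrow> is_lift d (F_jack \<eta>) (F_interp \<eta>)"
proof (elim subst)
  have "lookup (F_interp \<eta>) m = lookup (F_jack \<eta>) m" if "wt \<eta> \<le> wt m" for m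
    using that by (cases "wt m = wt \<eta>")
      (simp_all add: F_interp_def lookup_subst_uminus lookup_F_jack lookup_E_interp_eq_0
        flip: power_add mult.assoc)
  moreover have "eval (F_interp \<eta>) (\<lambda>i. - bar \<gamma> i) = 0" if "wt \<gamma> < wt \<eta>" for \<gamma>
    using that by (auto simp: F_interp_def eval_scale eval_subst_uminus intro!: eval_E_interp_eq_0)
  ultimately show "is_lift (wt \<eta>) (F_jack \<eta>) (F_interp \<eta>)" by (simp add: is_lift_iff)
qed

text \<open>\<open>f\<close> is a combination of the \<open>F_jack \<eta>\<close> with
  \<open>wt \<eta> = d\<close>, each of which has its image as a lift. Keeping \<open>T\<close>
  arbitrary lets this serve both the uniqueness of \<open>\<Xi>\<close> and the theorem.\<close>

lemma is_lift_linear_image: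
  assumes T: "Vector_Spaces.linear scale scale T" "\<And>\<eta>. T (F_jack \<eta>) = F_interp \<eta>"
    and f: "homogeneous d f"
  shows "is_lift d f (T f)"
proof -
  interpret T: Vector_Spaces.linear scale scale T by (rule T(1))
  obtain c where c: "f = (\<Sum>\<eta> | wt \<eta> = d. scale (c \<eta>) (F_jack \<eta>))"
    using homogeneous_F_jack_expansion[OF f] .
  have "T f = (\<Sum>\<eta> | wt \<eta> = d. scale (c \<eta>) (F_interp \<eta>))"
    by (simp add: c T.sum T.scale T(2))
  moreover have "is_lift d f (\<Sum>\<eta> | wt \<eta> = d. scale (c \<eta>) (F_interp \<eta>))"
    unfolding c by (intro is_lift_sum is_lift_F) simp
  ultimately show ?thesis by simp
qed

text \<open>\<open>T\<close> sends each monomial to a chosen lift, which settles well-definedness.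
  Then \<open>T (F_jack \<eta>)\<close> and \<open>F_interp \<eta>\<close> are both lifts of
  \<open>F_jack \<eta>\<close>, hence equal.\<close>

lemma linear_lift_exists:
  obtains T :: "'n::{finite,linorder} mpoly \<Rightarrow> 'n mpoly"
  where "Vector_Spaces.linear scale scale T" "\<And>\<eta>. T (F_jack \<eta>) = F_interp \<eta>"
proof -
  let ?x = "\<lambda>m :: 'n composition. Poly_Mapping.single m 1 :: 'n mpoly"
  have "\<exists>g. is_lift (wt m) (?x m) g" for m
  proof -
    have "homogeneous (wt m) (?x m)"
      by (auto simp: homogeneous_iff lookup_single when_def)
    then obtain c where c: "?x m = (\<Sum>\<eta> | wt \<eta> = wt m. scale (c \<eta>) (F_jack \<eta>))"
      by (rule homogeneous_F_jack_expansion)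
    show ?thesis
      unfolding c
      by (rule exI[of _ "\<Sum>\<eta> | wt \<eta> = wt m. scale (c \<eta>) (F_interp \<eta>)"])
        (intro is_lift_sum is_lift_F, simp)
  qed
  then have "\<forall>m. \<exists>g. is_lift (wt m) (?x m) g" by blast
  from choice[OF this] obtain G where G: "\<And>m. is_lift (wt m) (?x m) (G m)" by blast
  define T where "T = (\<lambda>p :: 'n mpoly. \<Sum>m\<in>keys p. scale (lookup p m) (G m))"
  have T_superset: "T p = (\<Sum>m\<in>A. scale (lookup p m) (G m))" if "finite A" "keys p \<subseteq> A" for A p
    unfolding T_def using that by (intro sum.mono_neutral_left) (auto simp: in_keys_iff)
  have lin: "Vector_Spaces.linear scale scale T"
    unfolding Vector_Spaces.linear_iff
  proof (intro conjI vector_space_scale allI)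
    fix p q :: "'n mpoly" and c
    let ?A = "keys p \<union> keys q"
    have "keys (p + q) \<subseteq> ?A" by (rule keys_add)
    then show "T (p + q) = T p + T q"
      by (simp add: T_superset[of ?A] lookup_add scale.scale_left_distrib sum.distrib)
    have "keys (scale c p) \<subseteq> keys p" by (auto simp: in_keys_iff)
    then show "T (scale c p) = scale c (T p)"
      by (simp add: T_superset[of "keys p"] scale.scale_sum_right)
  qed
  have "T (F_jack \<eta>) = F_interp \<eta>" for \<eta>
  proof (rule is_lift_unique[OF _ is_lift_F[OF refl]])
    \<comment> \<open>Homogeneity of \<open>F_jack \<eta>\<close> gives all its monomials the same
      weight, so their lifts can be added.\<close>
    have "is_lift (wt \<eta>) (?x m) (G m)" if "m \<in> keys (F_jack \<eta>)" for m
      using G[of m] that homogeneous_F_jack[of \<eta>] by (simp add: homogeneous_def)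
    then show "is_lift (wt \<eta>) (F_jack \<eta>) (T (F_jack \<eta>))"
      unfolding T_def by (subst poly_eq_sum_monomials[of "F_jack \<eta>"]) (rule is_lift_sum)
  qed
  with lin show ?thesis by (rule that)
qed

text \<open>Two such operators lift every monomial, so they agree on monomials and, by linearity,
  everywhere; with existence this justifies the definite description.\<close>

lemma \<Xi>_props:
  "Vector_Spaces.linear scale scale (\<Xi> :: 'n::{finite,linorder} mpoly \<Rightarrow> 'n mpoly) \<and>
     (\<forall>\<eta> :: 'n composition. \<Xi> (F_jack \<eta>) = F_interp \<eta>)"
proof -
  let ?P = "\<lambda>T :: 'n mpoly \<Rightarrow> 'n mpoly.
    Vector_Spaces.linear scale scale T \<and> (\<forall>\<eta>. T (F_jack \<eta>) = F_interp \<eta>)"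
  have "S = T" if S: "?P S" and T: "?P T" for S T
  proof
    fix p :: "'n mpoly"
    interpret S: Vector_Spaces.linear scale scale S using S by simp
    interpret T: Vector_Spaces.linear scale scale T using T by simp
    have "S (Poly_Mapping.single m 1) = T (Poly_Mapping.single m 1)" for m
    proof (rule is_lift_unique)
      have hom: "homogeneous (wt m) (Poly_Mapping.single m 1 :: 'n mpoly)"
        by (auto simp: homogeneous_iff lookup_single when_def)
      show "is_lift (wt m) (Poly_Mapping.single m 1) (S (Poly_Mapping.single m 1))"
        using S hom by (intro is_lift_linear_image) auto
      show "is_lift (wt m) (Poly_Mapping.single m 1) (T (Poly_Mapping.single m 1))"
        using T hom by (intro is_lift_linear_image) auto
    qed
    then have "(\<Sum>m\<in>keys p. scale (lookup p m) (S (Poly_Mapping.single m 1))) =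
        (\<Sum>m\<in>keys p. scale (lookup p m) (T (Poly_Mapping.single m 1)))"
      by simp
    then have "S (\<Sum>m\<in>keys p. scale (lookup p m) (Poly_Mapping.single m 1)) =
        T (\<Sum>m\<in>keys p. scale (lookup p m) (Poly_Mapping.single m 1))"
      by (simp only: S.sum S.scale T.sum T.scale)
    then show "S p = T p"
      by (simp only: poly_eq_sum_monomials[symmetric])
  qed
  moreover obtain T where "?P T"
    using linear_lift_exists by blast
  ultimately have "\<exists>!T. ?P T"
    by (intro ex1I[of _ T]) auto
  from theI'[OF this] show ?thesis
    unfolding \<Xi>_def .
qed

theorem theorem3p8:
  fixes f :: "'n::{finite,linorder} mpoly" and d :: nat
  assumes "homogeneous d f"
  shows "\<forall>g. g = \<Xi> f \<longleftrightarrow>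
           deg (g - f) < ereal (real d) \<and>
           (\<forall>\<eta>. wt \<eta> < d \<longrightarrow> eval g (\<lambda>i. - bar \<eta> i) = 0)"
  using is_lift_linear_image[OF _ _ assms, of \<Xi>] \<Xi>_props is_lift_unique[of d f]
  unfolding is_lift_def[symmetric] by blast

end
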